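(* Let $A\in\mathbb{R}^{n\times m}$, $k\in\{2,\dots,\min\{n,m\}\}$, $W=\begin{bmatrix} 0 & A \\ A^\top & 0 \end{bmatrix}\in\mathbb{S}^{n+m}$, and let $\mathrm{ML}_U,\mathrm{CL}_U\subseteq U\times U$, $\mathrm{ML}_V,\mathrm{CL}_V\subseteq V\times V$ be sets of must-link and cannot-link branching decisions as in the context, with $c_U=|\mathrm{ML}_U|$, $c_V=|\mathrm{ML}_V|$ and associated binary matrices $T_U\in\{0,1\}^{(n-c_U)\times n}$, $T_V\in\{0,1\}^{(m-c_V)\times m}$. Consider the two problems: (P1) maximize $\frac12\mathrm{tr}(WZ)$ over $Z=\begin{bmatrix} Z_{UU} & Z_{UV} \\ Z_{UV}^\top & Z_{VV} \end{bmatrix}\in\mathcal{P}$ subject to $(Z_{UU})_{ih}=(Z_{UU})_{jh}$ for all $u_h\in U$, $(u_i,u_j)\in\mathrm{ML}_U$; $(Z_{UV})_{ih}=(Z_{UV})_{jh}$ for all $v_h\in V$, $(u_i,u_j)\in\mathrm{ML}_U$; $(Z_{VV})_{ih}=(Z_{VV})_{jh}$ for all $v_h\in V$, $(v_i,v_j)\in\mathrm{ML}_V$; $(Z_{UV}^\top)_{ih}=(Z_{UV}^\top)_{jh}$ for all $u_h\in U$, $(v_i,v_j)\in\mathrm{ML}_V$; $(Z_{UU})_{ij}=0$ for all $(u_i,u_j)\in\mathrm{CL}_U$; $(Z_{VV})_{ij}=0$ for all $(v_i,v_j)\in\mathrm{CL}_V$. (P2) maximize $\langle T_UAT_V^\top,\bar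 Z_{UV}\rangle$ over $\bar Z=\begin{bmatrix} \bar Z_{UU} & \bar Z_{UV} \\ \bar Z_{UV}^\top & \bar Z_{VV} \end{bmatrix}\in\mathbb{S}_+^{(n-c_U)+(m-c_V)}$, $\bar Z\ge 0$ entrywise, subject to $\bar Z_{UU}T_U1_n=1_{n-c_U}$, $\bar Z_{VV}T_V1_m=1_{m-c_V}$, $\langle T_UT_U^\top,\bar Z_{UU}\rangle=k$, $\langle T_VT_V^\top,\bar Z_{VV}\rangle=k$, $(\bar Z_{UU})_{ab}=0$ for all $(a,b)\in\overline{\mathrm{CL}}_U$, $(\bar Z_{VV})_{ab}=0$ for all $(a,b)\in\overline{\mathrm{CL}}_V$, where $\overline{\mathrm{CL}}_U,\overline{\mathrm{CL}}_V$ are the cannot-link sets re-indexed to groups as in the context. Then (P1) and (P2) are equivalent: for every feasible solution of (P1) there is a feasible solution of (P2) with the same objective value, and for every feasible solution of (P2) there is a feasible solution of (P1) with the same objective value.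
   Context: $U=\{u_1,\dots,u_n\}$ and $V=\{v_1,\dots,v_m\}$ index the rows and columns of $A$. $\mathbb{S}^N$ is the space of real symmetric $N\times N$ matrices, $\mathbb{S}^N_+$ its positive semidefinite members, $1_N$ the all-ones vector in $\mathbb{R}^N$, and $\langle X,Y\rangle=\mathrm{tr}(Y^\top X)$. The set $\mathcal{P}$ consists of all block matrices $Z=\begin{bmatrix} Z_{UU} & Z_{UV} \\ Z_{UV}^\top & Z_{VV} \end{bmatrix}\in\mathbb{S}^{n+m}$ (with $Z_{UU}$ of size $n\times n$, $Z_{VV}$ of size $m\times m$, $Z_{UV}$ of size $n\times m$) such that $Z_{UU}1_n=1_n$, $Z_{VV}1_m=1_m$, $\mathrm{tr}(Z_{UU})=k$, $\mathrm{tr}(Z_{VV})=k$, $Z\ge0$ entrywise and $Z\in\mathbb{S}^{n+m}_+$. Must-link decisions: a pair in $\mathrm{ML}_U$ (resp. $\mathrm{ML}_V$) forces two vertices to be grouped together. The groups in $U$ are the connected components of the graph on $U$ with edge set $\mathrm{ML}_U$; each must-link decision merges two previously distinct groups (i.e. this graph is a forest), so that there are exactly $n-c_U$ groups. Enumerate the groups as $\sigma_U(1),\dots,\sigma_U(n-c_U)$; similarly $\sigma_V(1),\dots,\sigma_V(m-c_V)$ for $V$ and $\mathrm{ML}_V$. Then $(T_U)_{ij}=1$ if $u_j\in\sigma_U(i)$ and $0$ otherwise; $(T_V)_{ij}=1$ if $v_j\in\sigma_V(i)$ and $0$ otherwise. Cannot-link sets re-indexed to groups: $\overline{\mathrm{CL}}_U$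 is the set of pairs $(a,b)$ such that some $(u_i,u_j)\in\mathrm{CL}_U$ has $u_i\in\sigma_U(a)$ and $u_j\in\sigma_U(b)$; $\overline{\mathrm{CL}}_V$ is defined analogously. *)

theory Defs
  imports Complex_Main "Jordan_Normal_Form.Matrix"
begin

text \<open>
  Indices start at 0: the vertices \<open>u\<^sub>1, \<dots>, u\<^sub>n\<close> are \<open>0, \<dots>, n - 1\<close>, and the groups
  \<open>\<sigma>(1), \<dots>, \<sigma>(n - c)\<close> are \<open>\<sigma> 0, \<dots>, \<sigma> (n - c - 1)\<close>.
\<close>

definition ones :: "nat \<Rightarrow> real vec" where
  "ones N = vec N (\<lambda>_. 1)"

definition mat_trace :: "real mat \<Rightarrow> real" where
  "mat_trace X = (\<Sum>i<dim_row X. X $$ (i, i))"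

definition mat_inner :: "real mat \<Rightarrow> real mat \<Rightarrow> real" where
  "mat_inner X Y = mat_trace (transpose_mat Y * X)"

definition sym_mats :: "nat \<Rightarrow> real mat set" where
  "sym_mats N = {X \<in> carrier_mat N N. transpose_mat X = X}"

definition psd_mats :: "nat \<Rightarrow> real mat set" where
  "psd_mats N = {X \<in> sym_mats N. \<forall>x \<in> carrier_vec N. 0 \<le> x \<bullet> (X *\<^sub>v x)}"

definition entrywise_nonneg :: "real mat \<Rightarrow> bool" where
  "entrywise_nonneg X \<longleftrightarrow> (\<forall>i<dim_row X. \<forall>j<dim_col X. 0 \<le> X $$ (i, j))"

text \<open>
  The blocks of a square matrix whose upper left block is \<open>p \<times> p\<close>. Only symmetric matrices are
  used below, for which the lower left block is the transpose of the upper right one.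
\<close>

definition UU :: "nat \<Rightarrow> real mat \<Rightarrow> real mat" where
  "UU p Z = (case split_block Z p p of (ZUU, ZUV, ZVU, ZVV) \<Rightarrow> ZUU)"

definition UV :: "nat \<Rightarrow> real mat \<Rightarrow> real mat" where
  "UV p Z = (case split_block Z p p of (ZUU, ZUV, ZVU, ZVV) \<Rightarrow> ZUV)"

definition VV :: "nat \<Rightarrow> real mat \<Rightarrow> real mat" where
  "VV p Z = (case split_block Z p p of (ZUU, ZUV, ZVU, ZVV) \<Rightarrow> ZVV)"

lemma sym_mats_four_block:
  assumes "Z \<in> sym_mats (p + q)"
  shows "Z = four_block_mat (UU p Z) (UV p Z) (transpose_mat (UV p Z)) (VV p Z)"
proof (rule eq_matI)
  have Z: "Z \<in> carrier_mat (p + q) (p + q)" and s: "transpose_mat Z = Z"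
    using assms by (auto simp: sym_mats_def)
  show "dim_row Z = dim_row (four_block_mat (UU p Z) (UV p Z) (transpose_mat (UV p Z)) (VV p Z))"
    and "dim_col Z = dim_col (four_block_mat (UU p Z) (UV p Z) (transpose_mat (UV p Z)) (VV p Z))"
    using Z by (auto simp: UU_def VV_def split_block_def Let_def)
  have sym: "Z $$ (i, j) = Z $$ (j, i)" if "i < p + q" "j < p + q" for i j
    using that Z s by (metis carrier_matD index_transpose_mat(1))
  fix i j
  assume "i < dim_row (four_block_mat (UU p Z) (UV p Z) (transpose_mat (UV p Z)) (VV p Z))"
    and "j < dim_col (four_block_mat (UU p Z) (UV p Z) (transpose_mat (UV p Z)) (VV p Z))"
  then have "i < p + q" "j < p + q"
    using Z by (auto simp: UU_def VV_def split_block_def Let_def)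
  then show "Z $$ (i, j) =
      four_block_mat (UU p Z) (UV p Z) (transpose_mat (UV p Z)) (VV p Z) $$ (i, j)"
    using Z sym[of i j] by (auto simp: UU_def UV_def VV_def split_block_def Let_def)
qed

definition feasible_base :: "nat \<Rightarrow> nat \<Rightarrow> nat \<Rightarrow> real mat set" where
  "feasible_base n m k = {Z \<in> psd_mats (n + m).
     UU n Z *\<^sub>v ones n = ones n \<and> VV n Z *\<^sub>v ones m = ones m \<and>
     mat_trace (UU n Z) = real k \<and> mat_trace (VV n Z) = real k \<and>
     entrywise_nonneg Z}"

definition same_group :: "nat \<Rightarrow> (nat \<times> nat) set \<Rightarrow> (nat \<times> nat) set" where
  "same_group N ML = {(i, j). i < N \<and> j < N \<and> (i, j) \<in> (ML \<union> ML\<inverse>)\<^sup>*}"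

definition groups :: "nat \<Rightarrow> (nat \<times> nat) set \<Rightarrow> nat set set" where
  "groups N ML = {..<N} // same_group N ML"

text \<open>
  Sets of must-link decisions: each decision joins two vertices that lie in different groups
  of the earlier decisions. In other words, the pairs are the edges of a forest, and
  no edge occurs in both orientations.
\<close>

inductive must_link :: "nat \<Rightarrow> (nat \<times> nat) set \<Rightarrow> bool" for N where
  empty: "must_link N {}"
| merge: "must_link N ML \<Longrightarrow> i < N \<Longrightarrow> j < N \<Longrightarrow> (i, j) \<notin> same_group N ML
    \<Longrightarrow> must_link N (insert (i, j) ML)"

lemma equiv_same_group: "equiv {..<N} (same_group N ML)"
proof -
  have s: "sym ((ML \<union> ML\<inverse>)\<^sup>*)"
    by (intro sym_rtrancl) (auto simp: sym_def)
  show ?thesis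
    using s by (auto simp: equiv_def refl_on_def same_group_def sym_def trans_def)
qed

lemma same_group_insert:
  assumes "i < N" "j < N"
  shows "same_group N (insert (i, j) ML) = same_group N ML \<union>
    {(x, y). (x, i) \<in> same_group N ML \<and> (j, y) \<in> same_group N ML} \<union>
    {(x, y). (x, j) \<in> same_group N ML \<and> (i, y) \<in> same_group N ML}"
proof -
  have r: "insert (i, j) ML \<union> (insert (i, j) ML)\<inverse> = insert (i, j) (insert (j, i) (ML \<union> ML\<inverse>))"
    by auto
  have s: "sym ((ML \<union> ML\<inverse>)\<^sup>*)"
    by (intro sym_rtrancl) (auto simp: sym_def)
  show ?thesis
    unfolding same_group_def r rtrancl_insert
    using assms s by (auto dest: rtrancl_trans symD)
qed

lemma must_link_card_groups:
  assumes "must_link N ML"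
  shows "finite ML \<and> card (groups N ML) + card ML = N"
  using assms
proof induction
  case empty
  have "groups N {} = (\<lambda>x. {x}) ` {..<N}"
    by (auto simp: groups_def same_group_def quotient_def Image_def)
  then show ?case by (simp add: card_image)
next
  case (merge M i j)
  let ?E = "same_group N M" and ?E' = "same_group N (insert (i, j) M)"
  note eq = equiv_same_group[of N M]
  have notin: "(i, j) \<notin> M"
    using merge by (auto simp: same_group_def)
  let ?I = "?E `` {i}" and ?J = "?E `` {j}"
  have sym: "(y, x) \<in> ?E" if "(x, y) \<in> ?E" for x y
    using eq that by (meson equivE symD)
  have trans: "(x, z) \<in> ?E" if "(x, y) \<in> ?E" "(y, z) \<in> ?E" for x y z
    using eq that by (meson equivE transD)
  have refl: "(x, x) \<in> ?E" if "x < N" for x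
    using that by (auto simp: same_group_def)
  have cls: "?E' `` {x} = (if (x, i) \<in> ?E \<or> (x, j) \<in> ?E then ?I \<union> ?J else ?E `` {x})" for x
    unfolding same_group_insert[OF merge.hyps(2,3)]
    by (auto intro: sym trans)
  have bound: "x < N" "y < N" if "(x, y) \<in> ?E" for x y
    using that by (auto simp: same_group_def)
  have IJ: "?I \<noteq> ?J" using merge.hyps refl by blast
  have in_gr: "?I \<in> groups N M" "?J \<in> groups N M"
    using merge.hyps by (auto simp: groups_def quotient_def)
  have eqI: "?E `` {x} = ?I \<longleftrightarrow> (x, i) \<in> ?E" "?E `` {x} = ?J \<longleftrightarrow> (x, j) \<in> ?E" if "x < N" for x
    using that merge.hyps eq eq_equiv_class_iff[OF eq] by auto
  have gr: "groups N (insert (i, j) M) = insert (?I \<union> ?J) (groups N M - {?I, ?J})" (is "?L = ?R")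
  proof
    show "?L \<subseteq> ?R"
    proof
      fix X assume "X \<in> ?L"
      then obtain x where x: "x < N" "X = ?E' `` {x}"
        by (auto simp: groups_def quotient_def)
      show "X \<in> ?R"
      proof (cases "(x, i) \<in> ?E \<or> (x, j) \<in> ?E")
        case True
        then show ?thesis using x cls by auto
      next
        case False
        then have "X = ?E `` {x}" "X \<noteq> ?I" "X \<noteq> ?J" using x cls eqI by auto
        moreover have "?E `` {x} \<in> groups N M" using x by (auto simp: groups_def quotient_def)
        ultimately show ?thesis by blast
      qed
    qed
    show "?R \<subseteq> ?L"
    proof
      fix X assume "X \<in> ?R"
      then consider "X = ?I \<union> ?J" | x where "x < N" "X = ?E `` {x}" "X \<noteq> ?I" "X \<noteq> ?J"
        by (auto simp: groups_def quotient_def)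
      then show "X \<in> ?L"
      proof cases
        case 1
        then have "X = ?E' `` {i}" using refl merge.hyps cls by auto
        then show ?thesis using merge.hyps by (auto simp: groups_def quotient_def)
      next
        case 2
        then have "X = ?E' `` {x}" using eqI cls by auto
        then show ?thesis using 2 by (auto simp: groups_def quotient_def)
      qed
    qed
  qed
  have fin: "finite (groups N M)"
    by (simp add: groups_def quotient_def)
  have new: "?I \<union> ?J \<notin> groups N M"
  proof
    assume "?I \<union> ?J \<in> groups N M"
    then obtain x where "?I \<union> ?J = ?E `` {x}" by (auto simp: groups_def quotient_def)
    then have "(x, i) \<in> ?E" "(x, j) \<in> ?E" using refl merge.hyps by blast+
    then show False using merge.hyps sym trans by blast
  qed
  have "card {?I, ?J} \<le> card (groups N M)"
    using fin in_gr by (intro card_mono) auto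
  then have "card (groups N (insert (i, j) M)) + 1 = card (groups N M)"
    using fin new in_gr IJ by (simp add: gr card_Diff_subset)
  then show ?case using merge.IH notin by simp
qed

text \<open>
  There are \<open>N - card ML\<close> groups, so an enumeration of them indexed by \<open>{..<N - card ML}\<close> exists.
\<close>

lemma must_link_enumeration:
  assumes "must_link N ML"
  shows "\<exists>\<sigma>. bij_betw \<sigma> {..<N - card ML} (groups N ML)"
proof -
  have "finite (groups N ML)" by (simp add: groups_def quotient_def)
  moreover have "card (groups N ML) = N - card ML"
    using must_link_card_groups[OF assms] by linarith
  ultimately show ?thesis
    using finite_same_card_bij[of "{..<N - card ML}" "groups N ML"] by simp
qed

definition group_mat :: "nat \<Rightarrow> (nat \<times> nat) set \<Rightarrow> (nat \<Rightarrow> nat set) \<Rightarrow> real mat" where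
  "group_mat N ML \<sigma> = mat (N - card ML) N (\<lambda>(i, j). if j \<in> \<sigma> i then 1 else 0)"

definition group_cl ::
  "nat \<Rightarrow> (nat \<times> nat) set \<Rightarrow> (nat \<Rightarrow> nat set) \<Rightarrow> (nat \<times> nat) set \<Rightarrow> (nat \<times> nat) set" where
  "group_cl N ML \<sigma> CL =
     {(a, b). a < N - card ML \<and> b < N - card ML \<and> (\<exists>(i, j) \<in> CL. i \<in> \<sigma> a \<and> j \<in> \<sigma> b)}"

definition P1_feasible ::
  "nat \<Rightarrow> nat \<Rightarrow> nat \<Rightarrow> (nat \<times> nat) set \<Rightarrow> (nat \<times> nat) set \<Rightarrow> (nat \<times> nat) set \<Rightarrow> (nat \<times> nat) set
    \<Rightarrow> real mat set" where
  "P1_feasible n m k MLU MLV CLU CLV = {Z \<in> feasible_base n m k.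
     (\<forall>h<n. \<forall>(i, j) \<in> MLU. UU n Z $$ (i, h) = UU n Z $$ (j, h)) \<and>
     (\<forall>h<m. \<forall>(i, j) \<in> MLU. UV n Z $$ (i, h) = UV n Z $$ (j, h)) \<and>
     (\<forall>h<m. \<forall>(i, j) \<in> MLV. VV n Z $$ (i, h) = VV n Z $$ (j, h)) \<and>
     (\<forall>h<n. \<forall>(i, j) \<in> MLV.
        transpose_mat (UV n Z) $$ (i, h) = transpose_mat (UV n Z) $$ (j, h)) \<and>
     (\<forall>(i, j) \<in> CLU. UU n Z $$ (i, j) = 0) \<and>
     (\<forall>(i, j) \<in> CLV. VV n Z $$ (i, j) = 0)}"

definition P1_objective :: "nat \<Rightarrow> nat \<Rightarrow> real mat \<Rightarrow> real mat \<Rightarrow> real" where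
  "P1_objective n m A Z =
     (let W = four_block_mat (0\<^sub>m n n) A (transpose_mat A) (0\<^sub>m m m)
      in 1 / 2 * mat_trace (W * Z))"

definition P2_feasible ::
  "nat \<Rightarrow> nat \<Rightarrow> nat \<Rightarrow> (nat \<times> nat) set \<Rightarrow> (nat \<times> nat) set \<Rightarrow> (nat \<times> nat) set \<Rightarrow> (nat \<times> nat) set
    \<Rightarrow> (nat \<Rightarrow> nat set) \<Rightarrow> (nat \<Rightarrow> nat set) \<Rightarrow> real mat set" where
  "P2_feasible n m k MLU MLV CLU CLV \<sigma>U \<sigma>V =
     (let p = n - card MLU; q = m - card MLV;
          TU = group_mat n MLU \<sigma>U; TV = group_mat m MLV \<sigma>V
      in {Z \<in> psd_mats (p + q). entrywise_nonneg Z \<and>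
         UU p Z *\<^sub>v (TU *\<^sub>v ones n) = ones p \<and> VV p Z *\<^sub>v (TV *\<^sub>v ones m) = ones q \<and>
         mat_inner (TU * transpose_mat TU) (UU p Z) = real k \<and>
         mat_inner (TV * transpose_mat TV) (VV p Z) = real k \<and>
         (\<forall>(a, b) \<in> group_cl n MLU \<sigma>U CLU. UU p Z $$ (a, b) = 0) \<and>
         (\<forall>(a, b) \<in> group_cl m MLV \<sigma>V CLV. VV p Z $$ (a, b) = 0)})"

definition P2_objective ::
  "nat \<Rightarrow> nat \<Rightarrow> (nat \<times> nat) set \<Rightarrow> (nat \<times> nat) set \<Rightarrow> (nat \<Rightarrow> nat set) \<Rightarrow> (nat \<Rightarrow> nat set)
    \<Rightarrow> real mat \<Rightarrow> real mat \<Rightarrow> real" where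
  "P2_objective n m MLU MLV \<sigma>U \<sigma>V A Z =
     mat_inner (group_mat n MLU \<sigma>U * A * transpose_mat (group_mat m MLV \<sigma>V))
       (UV (n - card MLU) Z)"

end

theory Submission
  imports Defs
begin

text \<open>
  Let \<open>T\<close> be the block diagonal matrix with blocks \<open>T\<^sub>U\<close> and \<open>T\<^sub>V\<close>. The map \<open>X \<mapsto> T\<^sup>T X T\<close> copies the
  entry at a pair of groups to all pairs of their members, so its image consists of the symmetric
  matrices that are constant on groups, and choosing a representative of each group inverts it on
  these. Congruences preserve positive semidefiniteness, and since \<open>T\<close> and \<open>T\<^sup>T\<close> are adjoint
  for the trace inner product, the linear constraints and the objectives correspond.
\<close>

section \<open>Re-indexing as congruence with selection matrices\<close>

text \<open>Each column \<open>j\<close> has its single one in row \<open>g j\<close> when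
  \<open>g j < p\<close>. With \<open>g\<close> the group number of a vertex this is
  \<open>T_U\<close> or \<open>T_V\<close>; describing it by a function turns matrix products into
  substitutions of indices.\<close>

definition select_mat :: "nat \<Rightarrow> nat \<Rightarrow> (nat \<Rightarrow> nat) \<Rightarrow> real mat" where
  "select_mat p N g = mat p N (\<lambda>(a, j). if a = g j then 1 else 0)"

definition reindex_mat :: "nat \<Rightarrow> nat \<Rightarrow> (nat \<Rightarrow> nat) \<Rightarrow> (nat \<Rightarrow> nat) \<Rightarrow> real mat \<Rightarrow> real mat" where
  "reindex_mat n m f g X = mat n m (\<lambda>(i, j). X $$ (f i, g j))"

lemma select_mat_carrier [simp]:
  "select_mat p N g \<in> carrier_mat p N"
  "dim_row (select_mat p N g) = p" "dim_col (select_mat p N g) = N"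
  by (simp_all add: select_mat_def)

lemma reindex_mat_carrier [simp]:
  "reindex_mat n m f g X \<in> carrier_mat n m"
  "dim_row (reindex_mat n m f g X) = n" "dim_col (reindex_mat n m f g X) = m"
  by (simp_all add: reindex_mat_def)

lemma index_reindex_mat [simp]:
  "i < n \<Longrightarrow> j < m \<Longrightarrow> reindex_mat n m f g X $$ (i, j) = X $$ (f i, g j)"
  by (simp add: reindex_mat_def)

lemma transpose_select_mult_vec:
  assumes "v \<in> carrier_vec p" and "\<And>i. i < N \<Longrightarrow> g i < p"
  shows "transpose_mat (select_mat p N g) *\<^sub>v v = vec N (\<lambda>i. v $ g i)"
proof (rule eq_vecI)
  fix i assume "i < dim_vec (vec N (\<lambda>i. v $ g i))"
  then have i: "i < N" by simp
  have "(transpose_mat (select_mat p N g) *\<^sub>v v) $ i = (\<Sum>a<p. select_mat p N g $$ (a, i) * v $ a)"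
    using i assms(1) by (simp add: scalar_prod_def lessThan_atLeast0)
  also have "\<dots> = (\<Sum>a<p. if a = g i then v $ a else 0)"
    using i by (intro sum.cong) (auto simp: select_mat_def)
  finally show "(transpose_mat (select_mat p N g) *\<^sub>v v) $ i = vec N (\<lambda>i. v $ g i) $ i"
    using i assms by simp
qed (simp add: select_mat_def)

text \<open>The left factor replaces row indices by \<open>f\<close>, the right one column indices
  by \<open>g\<close>, since every sum in the product has only one nonzero term. Two separate maps
  are allowed so that the off-diagonal block \<open>UV\<close> is covered as well.\<close>

lemma select_congruence:
  assumes X: "X \<in> carrier_mat p q"
    and f: "\<And>i. i < n \<Longrightarrow> f i < p" and g: "\<And>j. j < m \<Longrightarrow> g j < q"
  shows "transpose_mat (select_mat p n f) * X * select_mat q m g = reindex_mat n m f g X"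
proof -
  let ?S = "transpose_mat (select_mat p n f)" and ?T = "select_mat q m g"
  have ST: "?S \<in> carrier_mat n p" "?T \<in> carrier_mat q m" by simp_all
  have SX: "(?S * X) $$ (i, b) = X $$ (f i, b)" if "i < n" "b < q" for i b
  proof -
    have "(?S * X) $$ (i, b) = (?S *\<^sub>v col X b) $ i"
      using that X by simp
    also have "\<dots> = X $$ (f i, b)"
      using that X f by (subst transpose_select_mult_vec) auto
    finally show ?thesis .
  qed
  show ?thesis
  proof (rule eq_matI)
    fix i j assume "i < dim_row (reindex_mat n m f g X)" "j < dim_col (reindex_mat n m f g X)"
    then have ij: "i < n" "j < m" by (simp_all add: reindex_mat_def)
    have "(?S * X * ?T) $$ (i, j) = (\<Sum>b<q. (?S * X) $$ (i, b) * ?T $$ (b, j))"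
      using ij X ST by (simp add: scalar_prod_def lessThan_atLeast0)
    also have "\<dots> = (\<Sum>b<q. if b = g j then X $$ (f i, b) else 0)"
      using ij by (intro sum.cong refl) (subst SX, auto simp: select_mat_def)
    also have "\<dots> = X $$ (f i, g j)"
      using ij g by simp
    finally show "(?S * X * ?T) $$ (i, j) = reindex_mat n m f g X $$ (i, j)"
      using ij by simp
  qed simp_all
qed

text \<open>The quadratic form of the product at \<open>x\<close> is the form of \<open>X\<close> at
  \<open>S *\<^sub>v x\<close>.\<close>

lemma psd_congruence:
  assumes X: "X \<in> psd_mats p" and S: "S \<in> carrier_mat p N"
  shows "transpose_mat S * X * S \<in> psd_mats N"
proof -
  have pos: "0 \<le> y \<bullet> (X *\<^sub>v y)" if "y \<in> carrier_vec p" for y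
    using X that by (auto simp: psd_mats_def sym_mats_def)
  have X_sym: "X \<in> carrier_mat p p" "transpose_mat X = X"
    using X by (auto simp: psd_mats_def sym_mats_def)
  have St: "transpose_mat S \<in> carrier_mat N p" using S by simp
  have "transpose_mat (transpose_mat S * X * S) = transpose_mat S * (X * S)"
    by (simp only: transpose_mult[OF mult_carrier_mat[OF St X_sym(1)] S] transpose_mult[OF St X_sym(1)]
        X_sym(2) transpose_transpose)
  then have "transpose_mat (transpose_mat S * X * S) = transpose_mat S * X * S"
    by (simp only: assoc_mult_mat[OF St X_sym(1) S])
  moreover have "0 \<le> x \<bullet> ((transpose_mat S * X * S) *\<^sub>v x)" if x: "x \<in> carrier_vec N" for x
  proof -
    have y: "S *\<^sub>v x \<in> carrier_vec p" using S x by simp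
    have "(transpose_mat S * X * S) *\<^sub>v x = transpose_mat S *\<^sub>v (X *\<^sub>v (S *\<^sub>v x))"
      by (simp only: assoc_mult_mat_vec[OF mult_carrier_mat[OF St X_sym(1)] S x]
          assoc_mult_mat_vec[OF St X_sym(1) y])
    moreover have w: "X *\<^sub>v (S *\<^sub>v x) \<in> carrier_vec p"
      by (rule mult_mat_vec_carrier[OF X_sym(1) y])
    ultimately have "x \<bullet> ((transpose_mat S * X * S) *\<^sub>v x) = (S *\<^sub>v x) \<bullet> (X *\<^sub>v (S *\<^sub>v x))"
      using transpose_vec_mult_scalar[OF S x w] comm_scalar_prod[OF x mult_mat_vec_carrier[OF St w]]
        comm_scalar_prod[OF w y] by simp
    then show ?thesis using pos[OF y] by simp
  qed
  ultimately show ?thesis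
    using X_sym S by (simp add: psd_mats_def sym_mats_def)
qed

text \<open>The map \<open>g\<close> is arbitrary, so the lemma serves both for copying entries to
  all members of a group and for restricting to representatives.\<close>

lemma reindex_psd:
  assumes "X \<in> psd_mats p" and "\<And>i. i < N \<Longrightarrow> g i < p"
  shows "reindex_mat N N g g X \<in> psd_mats N"
proof -
  have "X \<in> carrier_mat p p" using assms(1) by (simp add: psd_mats_def sym_mats_def)
  then have "transpose_mat (select_mat p N g) * X * select_mat p N g = reindex_mat N N g g X"
    using assms(2) by (intro select_congruence)
  with psd_congruence[OF assms(1) select_mat_carrier(1), of N g] show ?thesis by simp
qed

section \<open>Trace inner product and adjoints\<close>

lemma mat_trace_comm:
  assumes "X \<in> carrier_mat p q" and "Y \<in> carrier_mat q p"
  shows "mat_trace (X * Y) = mat_trace (Y * X)"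
proof -
  have "mat_trace (X * Y) = (\<Sum>i<p. \<Sum>j<q. X $$ (i, j) * Y $$ (j, i))"
    using assms by (simp add: mat_trace_def scalar_prod_def lessThan_atLeast0)
  also have "\<dots> = (\<Sum>j<q. \<Sum>i<p. Y $$ (j, i) * X $$ (i, j))"
    by (subst sum.swap) (simp add: mult.commute)
  also have "\<dots> = mat_trace (Y * X)"
    using assms by (simp add: mat_trace_def scalar_prod_def lessThan_atLeast0)
  finally show ?thesis .
qed

text \<open>Cyclicity of the trace moves \<open>transpose_mat T\<close> to the front, where it joins
  the other factors to form the transpose of \<open>transpose_mat S * Y * T\<close>.\<close>

lemma mat_inner_adjoint:
  assumes S: "S \<in> carrier_mat p n" and B: "B \<in> carrier_mat n m"
    and T: "T \<in> carrier_mat q m" and Y: "Y \<in> carrier_mat p q"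
  shows "mat_inner (S * B * transpose_mat T) Y = mat_inner B (transpose_mat S * Y * T)"
proof -
  have c: "transpose_mat S \<in> carrier_mat n p" "transpose_mat T \<in> carrier_mat m q"
    "transpose_mat Y \<in> carrier_mat q p" "transpose_mat S * Y \<in> carrier_mat n q"
    "S * B \<in> carrier_mat p m" "transpose_mat Y * (S * B) \<in> carrier_mat q m"
    using assms by simp_all
  have "mat_inner (S * B * transpose_mat T) Y = mat_trace (transpose_mat Y * (S * B) * transpose_mat T)"
    using c by (simp add: mat_inner_def assoc_mult_mat[OF c(3,5,2)])
  also have "\<dots> = mat_trace (transpose_mat T * (transpose_mat Y * (S * B)))"
    by (rule mat_trace_comm[OF c(6,2)])
  also have "transpose_mat T * (transpose_mat Y * (S * B)) = transpose_mat (transpose_mat S * Y * T) * B"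
    using assms c transpose_mult[OF c(4) T] transpose_mult[OF c(1) Y]
      assoc_mult_mat[OF c(3) S B] assoc_mult_mat[of "transpose_mat T" m q "transpose_mat Y * S" n B m]
    by simp
  finally show ?thesis by (simp add: mat_inner_def)
qed

lemma mat_inner_one: "X \<in> carrier_mat n n \<Longrightarrow> mat_inner (1\<^sub>m n) X = mat_trace X"
  by (simp add: mat_inner_def mat_trace_def)

section \<open>Blocks of a matrix and the objective of (P1)\<close>

lemma dim_blocks [simp]:
  assumes "Z \<in> carrier_mat (p + q) (p + q)"
  shows "UU p Z \<in> carrier_mat p p" "UV p Z \<in> carrier_mat p q" "VV p Z \<in> carrier_mat q q"
  using assms by (auto simp: UU_def UV_def VV_def split_block_def Let_def)

lemma index_blocks:
  assumes "Z \<in> carrier_mat (p + q) (p + q)"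
  shows "i < p \<Longrightarrow> j < p \<Longrightarrow> UU p Z $$ (i, j) = Z $$ (i, j)"
    and "i < p \<Longrightarrow> j < q \<Longrightarrow> UV p Z $$ (i, j) = Z $$ (i, p + j)"
    and "i < q \<Longrightarrow> j < q \<Longrightarrow> VV p Z $$ (i, j) = Z $$ (p + i, p + j)"
  using assms by (auto simp: UU_def UV_def VV_def split_block_def Let_def add.commute)

text \<open>As \<open>W\<close> has zero diagonal blocks, the trace of \<open>W * Z\<close> comes
  from the two products of \<open>A\<close> with the block \<open>UV n Z\<close>. Both have the same
  trace, which cancels the factor one half.\<close>

lemma P1_objective_inner:
  assumes A: "A \<in> carrier_mat n m" and Z: "Z \<in> sym_mats (n + m)"
  shows "P1_objective n m A Z = mat_inner A (UV n Z)"
proof -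
  have Zc: "Z \<in> carrier_mat (n + m) (n + m)" using Z by (simp add: sym_mats_def)
  note b = dim_blocks[OF Zc]
  have At: "transpose_mat A \<in> carrier_mat m n" and Bt: "transpose_mat (UV n Z) \<in> carrier_mat m n"
    using A b by simp_all
  let ?W = "four_block_mat (0\<^sub>m n n) A (transpose_mat A) (0\<^sub>m m m)"
  have WZ: "?W * Z = four_block_mat (A * transpose_mat (UV n Z)) (A * VV n Z)
      (transpose_mat A * UU n Z) (transpose_mat A * UV n Z)"
    by (subst sym_mats_four_block[OF Z],
        subst mult_four_block_mat[OF zero_carrier_mat A At zero_carrier_mat b(1,2) Bt b(3)])
      (use A At b Bt in simp)
  have tr: "mat_trace (four_block_mat P Q R S) = mat_trace P + mat_trace S"
    if "P \<in> carrier_mat n n" "S \<in> carrier_mat m m" for P Q R S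
  proof -
    let ?h = "\<lambda>i. four_block_mat P Q R S $$ (i, i)"
    have "mat_trace (four_block_mat P Q R S) = sum ?h {0..<n} + sum ?h {n..<n + m}"
      using that sum.atLeastLessThan_concat[of 0 n "n + m" ?h]
      by (simp add: mat_trace_def lessThan_atLeast0)
    also have "\<dots> = (\<Sum>i<n. P $$ (i, i)) + (\<Sum>i = n..<n + m. S $$ (i - n, i - n))"
      using that by (intro arg_cong2[of _ _ _ _ "(+)"] sum.cong) auto
    also have "(\<Sum>i = n..<n + m. S $$ (i - n, i - n)) = (\<Sum>i<m. S $$ (i, i))"
      using sum.shift_bounds_nat_ivl[of "\<lambda>i. S $$ (i - n, i - n)" 0 n m]
      by (simp add: lessThan_atLeast0 add.commute)
    finally show ?thesis using that by (simp add: mat_trace_def)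
  qed
  have t1: "mat_trace (A * transpose_mat (UV n Z)) = mat_inner A (UV n Z)"
    using mat_trace_comm[OF A Bt] by (simp add: mat_inner_def)
  have tt: "mat_trace (transpose_mat Y) = mat_trace Y" if "Y \<in> carrier_mat m m" for Y
    using that by (simp add: mat_trace_def)
  \<comment> \<open>The second diagonal block is the transpose of the matrix whose trace defines the
    inner product.\<close>
  have "mat_trace (transpose_mat A * UV n Z) = mat_trace (transpose_mat (transpose_mat (UV n Z) * A))"
    using transpose_mult[OF Bt A] by simp
  then have t2: "mat_trace (transpose_mat A * UV n Z) = mat_inner A (UV n Z)"
    using A Bt by (simp add: mat_inner_def tt[OF mult_carrier_mat[OF Bt A]])
  have "A * transpose_mat (UV n Z) \<in> carrier_mat n n" "transpose_mat A * UV n Z \<in> carrier_mat m m"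
    using A b by simp_all
  then show ?thesis
    by (simp add: P1_objective_def WZ tr t1 t2)
qed

section \<open>Group numbers and representatives\<close>

text \<open>\<open>g\<close> sends a vertex to the number of its group, and \<open>r\<close> picks a representative of each group.\<close>

definition group_index ::
  "nat \<Rightarrow> (nat \<times> nat) set \<Rightarrow> (nat \<Rightarrow> nat set) \<Rightarrow> (nat \<Rightarrow> nat) \<Rightarrow> (nat \<Rightarrow> nat) \<Rightarrow> bool" where
  "group_index N F \<sigma> g r \<longleftrightarrow>
     (\<forall>j<N. g j < N - card F) \<and>
     (\<forall>a<N - card F. r a < N \<and> g (r a) = a) \<and>
     (\<forall>a<N - card F. \<forall>j<N. j \<in> \<sigma> a \<longleftrightarrow> a = g j) \<and>
     (\<forall>i<N. \<forall>j<N. g i = g j \<longleftrightarrow> (i, j) \<in> same_group N F)"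

lemma group_indexD:
  assumes "group_index N F \<sigma> g r"
  shows "j < N \<Longrightarrow> g j < N - card F"
    and "a < N - card F \<Longrightarrow> r a < N"
    and "a < N - card F \<Longrightarrow> g (r a) = a"
    and "a < N - card F \<Longrightarrow> j < N \<Longrightarrow> j \<in> \<sigma> a \<longleftrightarrow> a = g j"
    and "i < N \<Longrightarrow> j < N \<Longrightarrow> g i = g j \<longleftrightarrow> (i, j) \<in> same_group N F"
  using assms by (simp_all add: group_index_def)

lemma group_index_exists:
  assumes bij: "bij_betw \<sigma> {..<N - card F} (groups N F)"
  obtains g r where "group_index N F \<sigma> g r"
proof -
  let ?E = "same_group N F" and ?p = "N - card F"
  note eq = equiv_same_group[of N F]
  \<comment> \<open>The enumeration is inverted at the class of \<open>j\<close>.\<close>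
  define g where "g j = inv_into {..<?p} \<sigma> (?E `` {j})" for j
  \<comment> \<open>Any member will do; one exists because \<open>\<sigma> a\<close> is an
    equivalence class, as \<open>surj\<close> shows below.\<close>
  define r where "r a = (SOME i. i < N \<and> g i = a)" for a
  have cls: "?E `` {j} \<in> groups N F" if "j < N" for j
    using that by (auto simp: groups_def quotient_def)
  have g: "g j < ?p" "\<sigma> (g j) = ?E `` {j}" if "j < N" for j
    using bij cls[OF that] inv_into_into[of "?E `` {j}" \<sigma> "{..<?p}"]
      f_inv_into_f[of "?E `` {j}" \<sigma> "{..<?p}"]
    by (auto simp: g_def bij_betw_def)
  have g_eq: "g i = g j \<longleftrightarrow> (i, j) \<in> ?E" if "i < N" "j < N" for i j
    using that g eq_equiv_class_iff[OF eq, of i j] by (metis g_def lessThan_iff)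
  have surj: "\<exists>i<N. \<sigma> a = ?E `` {i} \<and> g i = a" if "a < ?p" for a
  proof -
    have "\<sigma> a \<in> groups N F" using bij that by (auto simp: bij_betw_def)
    then obtain i where i: "i < N" "\<sigma> a = ?E `` {i}" by (auto simp: groups_def quotient_def)
    then have "g i = a"
      using g[OF i(1)] bij that by (auto simp: bij_betw_def inj_on_def)
    with i show ?thesis by blast
  qed
  have r: "r a < N \<and> g (r a) = a" if "a < ?p" for a
    unfolding r_def using someI_ex[of "\<lambda>i. i < N \<and> g i = a"] surj[OF that] by blast
  have mem: "j \<in> \<sigma> a \<longleftrightarrow> a = g j" if "a < ?p" "j < N" for a j
    using surj[OF that(1)] g_eq that(2) by force
  show thesis
    using that[of g r] g(1) r mem g_eq by (simp add: group_index_def)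
qed

lemma must_link_subset: "must_link N F \<Longrightarrow> F \<subseteq> {..<N} \<times> {..<N}"
  by (induction rule: must_link.induct) auto

lemma group_index_must_link:
  assumes "group_index N F \<sigma> g r" and "must_link N F" and "(i, j) \<in> F"
  shows "g i = g j"
proof -
  have "i < N" "j < N" using must_link_subset[OF assms(2)] assms(3) by auto
  moreover have "(i, j) \<in> (F \<union> F\<inverse>)\<^sup>*" using assms(3) by blast
  ultimately show ?thesis using group_indexD(5)[OF assms(1)] by (simp add: same_group_def)
qed

text \<open>A vertex and the representative of its group are joined by a chain of must-link pairs,
  traversed in either direction, and \<open>f\<close> is constant along each link. In the
  application \<open>f\<close> reads off an entry of a fixed column of \<open>Z\<close>.\<close>

lemma group_index_representative:
  assumes gi: "group_index N F \<sigma> g r" and f: "\<And>i j. (i, j) \<in> F \<Longrightarrow> f i = f j" and i: "i < N"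
  shows "f (r (g i)) = f i"
proof -
  note D = group_indexD[OF gi]
  have "(i, r (g i)) \<in> same_group N F"
    using D(1)[OF i] D(2,3)[of "g i"] D(5)[OF i, of "r (g i)"] by simp
  then have "(i, r (g i)) \<in> (F \<union> F\<inverse>)\<^sup>*"
    by (simp add: same_group_def)
  then show ?thesis
    by induction (auto dest: f)
qed

text \<open>Every group number is attained, because \<open>g (r a) = a\<close>.\<close>

lemma group_index_ball:
  assumes "group_index N F \<sigma> g r"
  shows "(\<forall>i<N. P (g i)) \<longleftrightarrow> (\<forall>a<N - card F. P a)"
proof (intro iffI allI impI)
  fix a assume "\<forall>i<N. P (g i)" and a: "a < N - card F"
  then have "P (g (r a))" using group_indexD(2)[OF assms a] by blast
  then show "P a" by (simp only: group_indexD(3)[OF assms a])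
next
  fix i assume "\<forall>a<N - card F. P a" "i < N"
  then show "P (g i)" using group_indexD(1)[OF assms] by blast
qed

lemma group_mat_select:
  assumes "group_index N F \<sigma> g r"
  shows "group_mat N F \<sigma> = select_mat (N - card F) N g"
  using assms by (auto simp: group_mat_def select_mat_def group_index_def intro!: eq_matI)

section \<open>Transfer of the individual constraints\<close>

text \<open>Applying the congruence to the all-ones vector yields
  \<open>transpose_mat T *\<^sub>v v\<close> with \<open>v\<close> the left side of the (P2)
  constraint. This copies \<open>v\<close> to the members of each group, so it is all ones exactly
  if \<open>v\<close> is.\<close>

lemma reindex_row_sums:
  assumes gi: "group_index N F \<sigma> g r" and X: "X \<in> carrier_mat (N - card F) (N - card F)"
  shows "reindex_mat N N g g X *\<^sub>v ones N = ones N \<longleftrightarrow>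
    X *\<^sub>v (group_mat N F \<sigma> *\<^sub>v ones N) = ones (N - card F)"
proof -
  let ?p = "N - card F" and ?T = "group_mat N F \<sigma>"
  have T: "?T \<in> carrier_mat ?p N" by (simp add: group_mat_def)
  have g: "\<And>i. i < N \<Longrightarrow> g i < ?p" using gi by (simp add: group_index_def)
  have ones: "ones N \<in> carrier_vec N" by (simp add: ones_def)
  define v where "v = X *\<^sub>v (?T *\<^sub>v ones N)"
  have v: "v \<in> carrier_vec ?p"
    unfolding v_def by (intro mult_mat_vec_carrier[OF X] mult_mat_vec_carrier[OF T] ones)
  have "reindex_mat N N g g X = transpose_mat ?T * X * ?T"
    using select_congruence[OF X g g] gi by (simp add: group_mat_select)
  then have "reindex_mat N N g g X *\<^sub>v ones N = transpose_mat ?T *\<^sub>v v"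
    using T X ones by (simp add: v_def assoc_mult_mat_vec[of _ N ?p _ N]
        assoc_mult_mat_vec[of _ N ?p _ ?p])
  also have "\<dots> = vec N (\<lambda>i. v $ g i)"
    using transpose_select_mult_vec[OF v g] gi by (simp add: group_mat_select)
  finally have "reindex_mat N N g g X *\<^sub>v ones N = ones N \<longleftrightarrow> (\<forall>i<N. v $ g i = 1)"
    by (auto simp: ones_def vec_eq_iff)
  also have "\<dots> \<longleftrightarrow> (\<forall>a<?p. v $ a = 1)"
    by (rule group_index_ball[OF gi])
  also have "\<dots> \<longleftrightarrow> v = ones ?p"
    using v by (auto simp: ones_def vec_eq_iff)
  finally show ?thesis by (simp add: v_def)
qed

text \<open>An instance of adjointness: it matches the objectives through the block
  \<open>UV\<close> and, with \<open>B\<close> the identity, the trace constraints.\<close>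

lemma reindex_inner:
  assumes "group_index n F \<sigma> g r" and "group_index m F' \<sigma>' g' r'"
    and "B \<in> carrier_mat n m" and "Y \<in> carrier_mat (n - card F) (m - card F')"
  shows "mat_inner (group_mat n F \<sigma> * B * transpose_mat (group_mat m F' \<sigma>')) Y
    = mat_inner B (reindex_mat n m g g' Y)"
  using assms(3,4) group_indexD(1)[OF assms(1)] group_indexD(1)[OF assms(2)]
  by (simp add: group_mat_select[OF assms(1)] group_mat_select[OF assms(2)]
      mat_inner_adjoint[OF select_mat_carrier(1) _ select_mat_carrier(1)]
      select_congruence)

lemma reindex_trace:
  assumes gi: "group_index N F \<sigma> g r" and X: "X \<in> carrier_mat (N - card F) (N - card F)"
  shows "mat_trace (reindex_mat N N g g X) =
    mat_inner (group_mat N F \<sigma> * transpose_mat (group_mat N F \<sigma>)) X"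
proof -
  have "group_mat N F \<sigma> * 1\<^sub>m N = group_mat N F \<sigma>" by (simp add: group_mat_def)
  then show ?thesis
    using reindex_inner[OF gi gi one_carrier_mat X] by (simp add: mat_inner_one)
qed

text \<open>The group pairs are precisely the images of the vertex pairs under \<open>g\<close>, and
  the re-indexed matrix at a vertex pair reads \<open>X\<close> at its image. The inclusion for
  \<open>CL\<close> keeps all entries inside the matrix.\<close>

lemma reindex_cannot_link:
  assumes gi: "group_index N F \<sigma> g r" and "CL \<subseteq> {..<N} \<times> {..<N}"
  shows "(\<forall>(i, j) \<in> CL. reindex_mat N N g g X $$ (i, j) = 0) \<longleftrightarrow>
    (\<forall>(a, b) \<in> group_cl N F \<sigma> CL. X $$ (a, b) = 0)"
proof -
  have "(a, b) \<in> group_cl N F \<sigma> CL \<longleftrightarrow> (\<exists>(i, j) \<in> CL. a = g i \<and> b = g j)" for a b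
    unfolding group_cl_def mem_Collect_eq prod.case
    using assms(2) group_indexD(1,4)[OF gi] by fast
  moreover have "reindex_mat N N g g X $$ (i, j) = X $$ (g i, g j)" if "(i, j) \<in> CL" for i j
    using that assms(2) by (intro index_reindex_mat) auto
  ultimately show ?thesis by fastforce
qed

section \<open>Combining the two index maps\<close>

text \<open>Selecting by this map corresponds to the block diagonal matrix with the two selection
  matrices as blocks; the second block starts at \<open>n\<close> in the source and at
  \<open>p\<close> in the target.\<close>

definition sum_index :: "nat \<Rightarrow> nat \<Rightarrow> (nat \<Rightarrow> nat) \<Rightarrow> (nat \<Rightarrow> nat) \<Rightarrow> nat \<Rightarrow> nat" where
  "sum_index n p f g i = (if i < n then f i else p + g (i - n))"

lemma sum_index_less:
  assumes "\<And>i. i < n \<Longrightarrow> f i < p" and "\<And>i. i < m \<Longrightarrow> g i < q" and "i < n + m"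
  shows "sum_index n p f g i < p + q"
  using assms by (auto simp: sum_index_def intro: trans_less_add1)

lemma reindex_blocks:
  assumes X: "X \<in> carrier_mat (p + q) (p + q)"
    and f: "\<And>i. i < n \<Longrightarrow> f i < p" and g: "\<And>i. i < m \<Longrightarrow> g i < q"
  defines "Z \<equiv> reindex_mat (n + m) (n + m) (sum_index n p f g) (sum_index n p f g) X"
  shows "UU n Z = reindex_mat n n f f (UU p X)"
    and "UV n Z = reindex_mat n m f g (UV p X)"
    and "VV n Z = reindex_mat m m g g (VV p X)"
proof -
  have Z: "Z \<in> carrier_mat (n + m) (n + m)" by (simp add: Z_def)
  note [simp] = index_blocks[OF X] index_blocks[OF Z] f g
  show "UU n Z = reindex_mat n n f f (UU p X)" "UV n Z = reindex_mat n m f g (UV p X)"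
    "VV n Z = reindex_mat m m g g (VV p X)"
    using dim_blocks[OF Z] by (auto intro!: eq_matI simp: reindex_mat_def)
      (auto simp: Z_def sum_index_def)
qed

section \<open>Passing between the two problems\<close>

text \<open>Besides the data of the problems, a numbering of the groups and a choice of
  representatives are fixed for both vertex sets.\<close>

locale grouping =
  fixes n m k :: nat and A :: "real mat" and MLU CLU MLV CLV :: "(nat \<times> nat) set"
    and \<sigma>U \<sigma>V :: "nat \<Rightarrow> nat set" and gU rU gV rV :: "nat \<Rightarrow> nat"
  assumes A: "A \<in> carrier_mat n m"
    and MLU: "must_link n MLU" and MLV: "must_link m MLV"
    and CLU: "CLU \<subseteq> {..<n} \<times> {..<n}" and CLV: "CLV \<subseteq> {..<m} \<times> {..<m}"
    and gU: "group_index n MLU \<sigma>U gU rU" and gV: "group_index m MLV \<sigma>V gV rV"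
begin

abbreviation "p \<equiv> n - card MLU"
abbreviation "q \<equiv> m - card MLV"
abbreviation "G \<equiv> sum_index n p gU gV"
abbreviation "R \<equiv> sum_index p n rU rV"
text \<open>This is the congruence of the proof idea, from group matrices to vertex matrices;
  \<open>collapse\<close> goes back by reading the entries at representatives.\<close>

abbreviation "expand \<equiv> reindex_mat (n + m) (n + m) G G"
abbreviation "collapse \<equiv> reindex_mat (p + q) (p + q) R R"

lemma index_less:
  "i < n \<Longrightarrow> gU i < p" "j < m \<Longrightarrow> gV j < q" "a < p \<Longrightarrow> rU a < n" "b < q \<Longrightarrow> rV b < m"
  by (simp_all add: group_indexD(1,2)[OF gU] group_indexD(1,2)[OF gV])

lemma G_less: "i < n + m \<Longrightarrow> G i < p + q"
  by (rule sum_index_less) (auto simp: index_less)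

lemma R_less: "a < p + q \<Longrightarrow> R a < n + m"
  by (rule sum_index_less) (auto simp: index_less)

text \<open>The opposite composite \<open>R (G i)\<close> merely stays in the group of
  \<open>i\<close>, which is why recovering \<open>Z\<close> in \<open>expand_collapse\<close>
  relies on the must-link constraints.\<close>

lemma G_R: "a < p + q \<Longrightarrow> G (R a) = a"
  by (simp add: sum_index_def group_indexD(2,3)[OF gU] group_indexD(3)[OF gV])

lemma expand_blocks:
  assumes "X \<in> carrier_mat (p + q) (p + q)"
  shows "UU n (expand X) = reindex_mat n n gU gU (UU p X)"
    and "UV n (expand X) = reindex_mat n m gU gV (UV p X)"
    and "VV n (expand X) = reindex_mat m m gV gV (VV p X)"
  by (simp_all add: reindex_blocks[OF assms] index_less(1,2))

text \<open>Both matrices have the same set of entries: the entry of \<open>X\<close> at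
  \<open>(a, b)\<close> reappears at the representatives.\<close>

lemma expand_nonneg:
  assumes X: "X \<in> carrier_mat (p + q) (p + q)"
  shows "entrywise_nonneg (expand X) \<longleftrightarrow> entrywise_nonneg X"
proof
  assume "entrywise_nonneg X"
  then show "entrywise_nonneg (expand X)"
    using X G_less by (simp add: entrywise_nonneg_def reindex_mat_def)
next
  assume e: "entrywise_nonneg (expand X)"
  show "entrywise_nonneg X"
    unfolding entrywise_nonneg_def
  proof (intro allI impI)
    fix a b assume "a < dim_row X" "b < dim_col X"
    then have ab: "a < p + q" "b < p + q" using X by auto
    then have "0 \<le> expand X $$ (R a, R b)"
      using e R_less by (simp add: entrywise_nonneg_def reindex_mat_def)
    then show "0 \<le> X $$ (a, b)" using ab R_less by (simp add: G_R)
  qed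
qed

text \<open>Being an equivalence, this serves both directions of the theorem. The must-link
  constraints hold for every expanded matrix, and the remaining constraints correspond one by
  one.\<close>

lemma expand_feasible:
  assumes X: "X \<in> psd_mats (p + q)"
  shows "expand X \<in> P1_feasible n m k MLU MLV CLU CLV \<longleftrightarrow>
    X \<in> P2_feasible n m k MLU MLV CLU CLV \<sigma>U \<sigma>V"
proof -
  have Xc: "X \<in> carrier_mat (p + q) (p + q)"
    using X by (simp add: psd_mats_def sym_mats_def)
  note b = expand_blocks[OF Xc]
  note d = dim_blocks[OF Xc]
  have U: "gU i = gU j" "i < n" "j < n" if "(i, j) \<in> MLU" for i j
    using group_index_must_link[OF gU MLU that] must_link_subset[OF MLU] that by auto
  have V: "gV i = gV j" "i < m" "j < m" if "(i, j) \<in> MLV" for i j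
    using group_index_must_link[OF gV MLV that] must_link_subset[OF MLV] that by auto
  have psd: "expand X \<in> psd_mats (n + m)"
    by (rule reindex_psd[OF X G_less])
  have t: "transpose_mat (reindex_mat n m gU gV (UV p X)) $$ (i, h) = UV p X $$ (gU h, gV i)"
    if "i < m" "h < n" for i h
    using that by (simp add: reindex_mat_def)
  \<comment> \<open>Linked vertices have the same group number, so both sides read the same entry of
    \<open>X\<close>.\<close>
  have links:
    "\<forall>h<n. \<forall>(i, j) \<in> MLU. reindex_mat n n gU gU (UU p X) $$ (i, h) = reindex_mat n n gU gU (UU p X) $$ (j, h)"
    "\<forall>h<m. \<forall>(i, j) \<in> MLU. reindex_mat n m gU gV (UV p X) $$ (i, h) = reindex_mat n m gU gV (UV p X) $$ (j, h)"
    "\<forall>h<m. \<forall>(i, j) \<in> MLV. reindex_mat m m gV gV (VV p X) $$ (i, h) = reindex_mat m m gV gV (VV p X) $$ (j, h)"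
    "\<forall>h<n. \<forall>(i, j) \<in> MLV. transpose_mat (reindex_mat n m gU gV (UV p X)) $$ (i, h)
       = transpose_mat (reindex_mat n m gU gV (UV p X)) $$ (j, h)"
    using U V t by fastforce+
  show ?thesis
    unfolding P1_feasible_def feasible_base_def P2_feasible_def Let_def mem_Collect_eq b
      reindex_row_sums[OF gU d(1)] reindex_row_sums[OF gV d(3)]
      reindex_trace[OF gU d(1)] reindex_trace[OF gV d(3)]
      reindex_cannot_link[OF gU CLU] reindex_cannot_link[OF gV CLV] expand_nonneg[OF Xc]
    using X psd links by blast
qed

lemma expand_objective:
  assumes X: "X \<in> psd_mats (p + q)"
  shows "P1_objective n m A (expand X) = P2_objective n m MLU MLV \<sigma>U \<sigma>V A X"
proof -
  have Xc: "X \<in> carrier_mat (p + q) (p + q)" using X by (simp add: psd_mats_def sym_mats_def)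
  have s: "expand X \<in> sym_mats (n + m)"
    using reindex_psd[OF X G_less] by (simp add: psd_mats_def)
  show ?thesis
    unfolding P1_objective_inner[OF A s] P2_objective_def reindex_inner[OF gU gV A dim_blocks(2)[OF Xc]]
      expand_blocks(2)[OF Xc] ..
qed

text \<open>The must-link constraints make full rows of \<open>Z\<close> agree within a group, and
  symmetry gives the same for columns. Replacing both indices by representatives therefore leaves
  the entry unchanged.\<close>

lemma expand_collapse:
  assumes Z: "Z \<in> P1_feasible n m k MLU MLV CLU CLV"
  shows "expand (collapse Z) = Z"
proof -
  have Zc: "Z \<in> carrier_mat (n + m) (n + m)" and Zs: "transpose_mat Z = Z"
    using Z by (auto simp: P1_feasible_def feasible_base_def psd_mats_def sym_mats_def)
  note [simp] = index_blocks[OF Zc]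
  note d = dim_blocks[OF Zc]
  have sym: "Z $$ (i, j) = Z $$ (j, i)" if "i < n + m" "j < n + m" for i j
    using that Zc Zs by (metis carrier_matD index_transpose_mat(1))
  \<comment> \<open>The constraint on \<open>UU\<close> covers the columns below \<open>n\<close>,
    the one on \<open>UV\<close> the others.\<close>
  have rowU: "Z $$ (i, h) = Z $$ (j, h)" if "(i, j) \<in> MLU" "h < n + m" for i j h
  proof -
    have ij: "i < n" "j < n" using must_link_subset[OF MLU] that by auto
    show ?thesis
    proof (cases "h < n")
      case True
      then have "UU n Z $$ (i, h) = UU n Z $$ (j, h)"
        using Z that(1) by (auto simp: P1_feasible_def)
      with True ij show ?thesis by simp
    next
      case False
      then have h: "h - n < m" using that by simp
      then have "UV n Z $$ (i, h - n) = UV n Z $$ (j, h - n)"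
        using Z that(1) by (auto simp: P1_feasible_def)
      with False h ij show ?thesis by simp
    qed
  qed
  have rowV: "Z $$ (n + i, h) = Z $$ (n + j, h)" if "(i, j) \<in> MLV" "h < n + m" for i j h
  proof -
    have ij: "i < m" "j < m" using must_link_subset[OF MLV] that by auto
    show ?thesis
    proof (cases "h < n")
      case True
      then have "transpose_mat (UV n Z) $$ (i, h) = transpose_mat (UV n Z) $$ (j, h)"
        using Z that(1) by (auto simp: P1_feasible_def)
      \<comment> \<open>The lower left block is accessible only as the transpose of
        \<open>UV\<close>, hence the appeal to symmetry.\<close>
      with True ij d show ?thesis by (simp add: sym[of "n + i" h] sym[of "n + j" h])
    next
      case False
      then have h: "h - n < m" using that by simp
      then have "VV n Z $$ (i, h - n) = VV n Z $$ (j, h - n)"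
        using Z that(1) by (auto simp: P1_feasible_def)
      with False h ij show ?thesis by simp
    qed
  qed
  have row: "Z $$ (R (G i), h) = Z $$ (i, h)" if i: "i < n + m" and h: "h < n + m" for i h
  proof (cases "i < n")
    case True
    then show ?thesis
      using group_index_representative[OF gU, of "\<lambda>i. Z $$ (i, h)", OF rowU[OF _ h] True]
      by (simp add: sum_index_def index_less)
  next
    case False
    then have "i - n < m" using i by simp
    with False show ?thesis
      using group_index_representative[OF gV, of "\<lambda>i. Z $$ (n + i, h)", OF rowV[OF _ h], of "i - n"]
      by (simp add: sum_index_def)
  qed
  show ?thesis
  proof (rule eq_matI)
    fix i j assume "i < dim_row Z" "j < dim_col Z"
    then have ij: "i < n + m" "j < n + m" using Zc by auto
    then have RG: "R (G i) < n + m" "R (G j) < n + m" using R_less G_less by auto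
    have "expand (collapse Z) $$ (i, j) = Z $$ (R (G i), R (G j))"
      using ij G_less by simp
    \<comment> \<open>The row index is replaced first; swapping the indices then lets
      \<open>row\<close> handle the column index too.\<close>
    also have "\<dots> = Z $$ (R (G j), i)"
      using row[OF ij(1) RG(2)] sym[OF ij(1) RG(2)] by simp
    also have "\<dots> = Z $$ (i, j)"
      using row[OF ij(2,1)] sym[OF ij] by simp
    finally show "expand (collapse Z) $$ (i, j) = Z $$ (i, j)" .
  qed (use Zc in \<open>simp_all add: reindex_mat_def\<close>)
qed

lemma P1_P2_equivalent:
  "(\<forall>Z \<in> P1_feasible n m k MLU MLV CLU CLV.
      \<exists>X \<in> P2_feasible n m k MLU MLV CLU CLV \<sigma>U \<sigma>V.
        P2_objective n m MLU MLV \<sigma>U \<sigma>V A X = P1_objective n m A Z) \<and>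
   (\<forall>X \<in> P2_feasible n m k MLU MLV CLU CLV \<sigma>U \<sigma>V.
      \<exists>Z \<in> P1_feasible n m k MLU MLV CLU CLV.
        P1_objective n m A Z = P2_objective n m MLU MLV \<sigma>U \<sigma>V A X)"
proof (intro conjI ballI)
  fix Z assume Z: "Z \<in> P1_feasible n m k MLU MLV CLU CLV"
  then have "Z \<in> psd_mats (n + m)"
    by (simp add: P1_feasible_def feasible_base_def)
  \<comment> \<open>The witness for (P2) is \<open>collapse Z\<close>. Since expanding it returns
    \<open>Z\<close>, feasibility and objective value of \<open>Z\<close> carry over to it.\<close>
  then have "collapse Z \<in> psd_mats (p + q)"
    by (rule reindex_psd[OF _ R_less])
  from expand_feasible[OF this] expand_objective[OF this] expand_collapse[OF Z] Z
  show "\<exists>X \<in> P2_feasible n m k MLU MLV CLU CLV \<sigma>U \<sigma>V.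
      P2_objective n m MLU MLV \<sigma>U \<sigma>V A X = P1_objective n m A Z"
    by metis
next
  fix X assume X: "X \<in> P2_feasible n m k MLU MLV CLU CLV \<sigma>U \<sigma>V"
  \<comment> \<open>Here the witness for (P1) is \<open>expand X\<close>.\<close>
  then have "X \<in> psd_mats (p + q)"
    by (simp add: P2_feasible_def Let_def)
  from expand_feasible[OF this] expand_objective[OF this] X
  show "\<exists>Z \<in> P1_feasible n m k MLU MLV CLU CLV.
      P1_objective n m A Z = P2_objective n m MLU MLV \<sigma>U \<sigma>V A X"
    by blast
qed

end

theorem theorem4p6:
  fixes n m k :: nat
    and A :: "real mat"
    and MLU CLU MLV CLV :: "(nat \<times> nat) set"
    and \<sigma>U \<sigma>V :: "nat \<Rightarrow> nat set"
  assumes "A \<in> carrier_mat n m"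
    and "k \<in> {2..min n m}"
    and "must_link n MLU"
    and "must_link m MLV"
    and "CLU \<subseteq> {..<n} \<times> {..<n}"
    and "CLV \<subseteq> {..<m} \<times> {..<m}"
    and "bij_betw \<sigma>U {..<n - card MLU} (groups n MLU)"
    and "bij_betw \<sigma>V {..<m - card MLV} (groups m MLV)"
  shows "(\<forall>Z \<in> P1_feasible n m k MLU MLV CLU CLV.
            \<exists>Zb \<in> P2_feasible n m k MLU MLV CLU CLV \<sigma>U \<sigma>V.
              P2_objective n m MLU MLV \<sigma>U \<sigma>V A Zb = P1_objective n m A Z) \<and>
         (\<forall>Zb \<in> P2_feasible n m k MLU MLV CLU CLV \<sigma>U \<sigma>V.
            \<exists>Z \<in> P1_feasible n m k MLU MLV CLU CLV.
              P1_objective n m A Z = P2_objective n m MLU MLV \<sigma>U \<sigma>V A Zb)"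
proof -
  obtain gU rU gV rV where "group_index n MLU \<sigma>U gU rU" and "group_index m MLV \<sigma>V gV rV"
    using assms(7,8) by (meson group_index_exists)
  then interpret grouping n m k A MLU CLU MLV CLV \<sigma>U \<sigma>V gU rU gV rV
    using assms(1,3-6) by unfold_locales
  show ?thesis by (rule P1_P2_equivalent)
qed

end
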